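(* Let $\beta,\psi_0$ be real constants, $\kappa>0$, $K\neq0$, and $I=\{r>0: r>4K\}$. Set $\tilde{\mathcal{C}}\equiv0$, $\mathcal{V}\equiv0$, $\mathcal{A}(\psi)=\frac{3\beta}{8}\psi^2$, $C(r)=1$, $$A(r)=2-\frac{r}{2K}+\frac{\sqrt{r(r-4K)}}{2K},\qquad \psi(r)=\frac{\psi_0\big(\sqrt{r(r-4K)}-4K+r\big)\big(\sqrt{r(r-4K)}-2K+r\big)^{1/4}}{3K\,r^{3/4}\sqrt{r-4K}} .$$ Then $E^{(1)}_{tt}=E^{(1)}_{rr}=E^{(1)}_{\vartheta\vartheta}=E^{(1)}_{\psi}=0$ hold on $I$. (The metric ${\rm d}s^2=A^2{\rm d}t^2-A^{-2}{\rm d}r^2-r^2{\rm d}\Omega^2$ is asymptotically flat, with $A(r)\to1$ as $r\to\infty$, and for $K>0$ has a horizon $A(4K)=0$.)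
   Context: Metric ansatz ${\rm d}s^2=A(r)^2{\rm d}t^2-\frac{C(r)^2}{A(r)^2}{\rm d}r^2-r^2{\rm d}\Omega^2$, $\psi=\psi(r)$. Primes on $A,C,\psi$ are $r$-derivatives; $\mathcal{A}',\tilde{\mathcal{C}}',\tilde{\mathcal{C}}'',\mathcal{V}'$ are $\psi$-derivatives evaluated at $\psi(r)$. The real-tetrad reduced vacuum field equations of the scalar-torsion theory are: $E^{(1)}_{tt}:\ 0=\mathcal{A}\frac{A^2(-2rACA'-A^2(C-2rC')+C^3)}{r^2C^3}+\tilde{\mathcal{C}}'\Big(\frac{A^4\psi''}{C^2}-\frac{A^3\psi'(-rCA'+rAC'-2C^2)}{rC^3}\Big)-\frac{2A^3(A-C)\psi'\mathcal{A}'}{rC^2}+\frac{A^4\psi'^2\tilde{\mathcal{C}}''}{C^2}-\frac{\beta A^4\psi'^2}{2C^2}+\kappa^2A^2\mathcal{V}$; $E^{(1)}_{rr}:\ 0=-\frac{(2rAA'+A^2-C^2)\mathcal{A}}{r^2A^2}+\big(\frac{A'}{A}+\frac2r\big)\psi'\tilde{\mathcal{C}}'+\frac{\kappa^2C^2\mathcal{V}}{A^2}+\frac12\beta\psi'^2$; $E^{(1)}_{\vartheta\vartheta}:\ 0=-\frac{A\psi'(rA'+A-C)\mathcal{A}'}{rC^2}+\tilde{\mathcal{C}}'\Big(\frac{A\psi'(rCA'-rAC'+C^2)}{rC^3}+\frac{A^2\psi''}{C^2}\Big)+\frac{\mathcal{A}(-rCA'^2+A(rA'C'-C(rA''+2A'))+A^2C')}{rC^3}+\frac{A^2\psi'^2\tilde{\mathcal{C}}''}{C^2}-\frac{\beta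 A^2\psi'^2}{2C^2}+\kappa^2\mathcal{V}$; $E^{(1)}_{\psi}:\ 0=\frac{(A-C)(2rA'+A-C)\mathcal{A}'}{r^2C^2}+\frac{\beta A\psi'(2rCA'+A(2C-rC'))}{rC^3}+\frac{\beta A^2\psi''}{C^2}+\kappa^2\mathcal{V}'+\frac{\tilde{\mathcal{C}}'(rCA'(rA'-2C)+A(-r^2A'C'+rC(rA''+6A')-2C^2)+2A^2(C-rC'))}{r^2C^3}$. *)

theory Defs
  imports "HOL-Analysis.Analysis"
begin

text \<open>Reduced vacuum field equations of the scalar-torsion theory (real tetrad).
  Arguments: beta, kappa, the scalar functions calA, calCt (tilde C), calV of psi,
  the metric functions A, C of r, the scalar field psi of r, and the radius r.\<close>

definition E_tt :: "real \<Rightarrow> real \<Rightarrow> (real\<Rightarrow>real) \<Rightarrow> (real\<Rightarrow>real) \<Rightarrow> (real\<Rightarrow>real)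
    \<Rightarrow> (real\<Rightarrow>real) \<Rightarrow> (real\<Rightarrow>real) \<Rightarrow> (real\<Rightarrow>real) \<Rightarrow> real \<Rightarrow> real" where
  "E_tt \<beta> \<kappa> cA cC cV A C \<psi> r =
    (let a = A r; a1 = deriv A r; c = C r; c1 = deriv C r;
         s = \<psi> r; p1 = deriv \<psi> r; p2 = deriv (deriv \<psi>) r;
         SA = cA s; SA1 = deriv cA s; SC1 = deriv cC s; SC2 = deriv (deriv cC) s; SV = cV s
     in SA * (a^2 * (-2*r*a*c*a1 - a^2*(c - 2*r*c1) + c^3)) / (r^2 * c^3)
        + SC1 * (a^4 * p2 / c^2 - a^3 * p1 * (-r*c*a1 + r*a*c1 - 2*c^2) / (r * c^3))
        - 2 * a^3 * (a - c) * p1 * SA1 / (r * c^2)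
        + a^4 * p1^2 * SC2 / c^2
        - \<beta> * a^4 * p1^2 / (2 * c^2)
        + \<kappa>^2 * a^2 * SV)"

definition E_rr :: "real \<Rightarrow> real \<Rightarrow> (real\<Rightarrow>real) \<Rightarrow> (real\<Rightarrow>real) \<Rightarrow> (real\<Rightarrow>real)
    \<Rightarrow> (real\<Rightarrow>real) \<Rightarrow> (real\<Rightarrow>real) \<Rightarrow> (real\<Rightarrow>real) \<Rightarrow> real \<Rightarrow> real" where
  "E_rr \<beta> \<kappa> cA cC cV A C \<psi> r =
    (let a = A r; a1 = deriv A r; c = C r;
         s = \<psi> r; p1 = deriv \<psi> r;
         SA = cA s; SC1 = deriv cC s; SV = cV s
     in - (2*r*a*a1 + a^2 - c^2) * SA / (r^2 * a^2)
        + (a1 / a + 2 / r) * p1 * SC1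
        + \<kappa>^2 * c^2 * SV / a^2
        + 1/2 * \<beta> * p1^2)"

definition E_thth :: "real \<Rightarrow> real \<Rightarrow> (real\<Rightarrow>real) \<Rightarrow> (real\<Rightarrow>real) \<Rightarrow> (real\<Rightarrow>real)
    \<Rightarrow> (real\<Rightarrow>real) \<Rightarrow> (real\<Rightarrow>real) \<Rightarrow> (real\<Rightarrow>real) \<Rightarrow> real \<Rightarrow> real" where
  "E_thth \<beta> \<kappa> cA cC cV A C \<psi> r =
    (let a = A r; a1 = deriv A r; a2 = deriv (deriv A) r; c = C r; c1 = deriv C r;
         s = \<psi> r; p1 = deriv \<psi> r; p2 = deriv (deriv \<psi>) r;
         SA = cA s; SA1 = deriv cA s; SC1 = deriv cC s; SC2 = deriv (deriv cC) s; SV = cV s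
     in - a * p1 * (r*a1 + a - c) * SA1 / (r * c^2)
        + SC1 * (a * p1 * (r*c*a1 - r*a*c1 + c^2) / (r * c^3) + a^2 * p2 / c^2)
        + SA * (-r*c*a1^2 + a*(r*a1*c1 - c*(r*a2 + 2*a1)) + a^2*c1) / (r * c^3)
        + a^2 * p1^2 * SC2 / c^2
        - \<beta> * a^2 * p1^2 / (2 * c^2)
        + \<kappa>^2 * SV)"

definition E_psi :: "real \<Rightarrow> real \<Rightarrow> (real\<Rightarrow>real) \<Rightarrow> (real\<Rightarrow>real) \<Rightarrow> (real\<Rightarrow>real)
    \<Rightarrow> (real\<Rightarrow>real) \<Rightarrow> (real\<Rightarrow>real) \<Rightarrow> (real\<Rightarrow>real) \<Rightarrow> real \<Rightarrow> real" where
  "E_psi \<beta> \<kappa> cA cC cV A C \<psi> r =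
    (let a = A r; a1 = deriv A r; a2 = deriv (deriv A) r; c = C r; c1 = deriv C r;
         s = \<psi> r; p1 = deriv \<psi> r; p2 = deriv (deriv \<psi>) r;
         SA1 = deriv cA s; SC1 = deriv cC s; SV1 = deriv cV s
     in (a - c) * (2*r*a1 + a - c) * SA1 / (r^2 * c^2)
        + \<beta> * a * p1 * (2*r*c*a1 + a*(2*c - r*c1)) / (r * c^3)
        + \<beta> * a^2 * p2 / c^2
        + \<kappa>^2 * SV1
        + SC1 * (r*c*a1*(r*a1 - 2*c) + a*(-(r^2)*a1*c1 + r*c*(r*a2 + 6*a1) - 2*c^2)
                 + 2*a^2*(c - r*c1)) / (r^2 * c^3))"

end

(*
  Put w = sqrt (1 - 4K/r). Then A = 2w/(1 + w) and psi = c (1 + w) powr (3/2) with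
  c = psi0 / (3 K 2 powr (1/4)), and w' = (1 - w^2)/(2 r w) shows that (A, psi) solves the
  first-order system

    r A A' = (1 - A)(2 - A),      2 r A psi' = 3 (1 - A) psi.

  For C = 1, tilde C = V = 0 and calA = 3 beta psi^2 / 8 every field equation becomes a rational
  identity in r, A, psi once A', psi' are eliminated by the system and A'', psi'' by its
  derivative. In E_rr, for instance, 2 r A A' + A^2 - 1 = 3 (1 - A)^2, which balances
  beta psi'^2 / 2 exactly.
*)
theory Submission
  imports Defs
begin

lemma deriv_deriv_eqI:
  fixes f g :: "real \<Rightarrow> real"
  assumes "open S" "x \<in> S"
    and f: "\<And>y. y \<in> S \<Longrightarrow> (f has_real_derivative g y) (at y)"
    and g: "(g has_real_derivative g') (at x)"
  shows "deriv (deriv f) x = g'"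
proof -
  have "eventually (\<lambda>y. deriv f y = g y) (nhds x)"
    using eventually_nhds_in_open[OF assms(1,2)] by eventually_elim (use f DERIV_imp_deriv in blast)
  then have "deriv (deriv f) x = deriv g x" by (rule deriv_cong_ev) simp
  also have "\<dots> = g'" using g by (rule DERIV_imp_deriv)
  finally show ?thesis .
qed

lemma field_equation_identities:
  fixes r a a1 a2 s p1 p2 \<beta> :: real
  assumes "r > 0" "a \<noteq> 0"
    and a1: "a1 = (1 - a) * (2 - a) / (r * a)"
    and a2: "a2 = ((a - 3) * a1 - r * a1^2) / (r * a)"
    and p1: "p1 = 3 * (1 - a) * s / (2 * r * a)"
    and p2: "p2 = ((3 - 5 * a) * p1 - 3 * a1 * s - 2 * r * a1 * p1) / (2 * r * a)"
  shows "3 * \<beta> / 8 * s^2 * (a^2 * (-2 * r * a * a1 - a^2 + 1)) / r^2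
           - 2 * a^3 * (a - 1) * p1 * (3 * \<beta> / 4 * s) / r - \<beta> * a^4 * p1^2 / 2 = 0"
    and "- (2 * r * a * a1 + a^2 - 1) * (3 * \<beta> / 8 * s^2) / (r^2 * a^2) + 1/2 * \<beta> * p1^2 = 0"
    and "- a * p1 * (r * a1 + a - 1) * (3 * \<beta> / 4 * s) / r
           + 3 * \<beta> / 8 * s^2 * (a * (- (r * a2) - 2 * a1) - r * a1^2) / r - \<beta> * a^2 * p1^2 / 2 = 0"
    and "(a - 1) * (2 * r * a1 + a - 1) * (3 * \<beta> / 4 * s) / r^2
           + \<beta> * a * p1 * (2 * r * a1 + a * 2) / r + \<beta> * a^2 * p2 = 0"
  using assms(1,2) unfolding p2 a2 p1 a1
  by (simp_all add: field_simps) (simp_all add: algebra_simps eval_nat_numeral)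

lemma field_equations_of_first_order_system:
  fixes A \<psi> :: "real \<Rightarrow> real" and S :: "real set" and \<beta> \<kappa> :: real
  assumes "open S" and r: "r \<in> S"
    and pos: "\<And>r. r \<in> S \<Longrightarrow> 0 < r \<and> A r \<noteq> 0"
    and dA: "\<And>r. r \<in> S \<Longrightarrow> (A has_real_derivative (1 - A r) * (2 - A r) / (r * A r)) (at r)"
    and d\<psi>: "\<And>r. r \<in> S \<Longrightarrow> (\<psi> has_real_derivative 3 * (1 - A r) * \<psi> r / (2 * r * A r)) (at r)"
  defines "cA \<equiv> \<lambda>s. 3 * \<beta> / 8 * s^2" and "cC \<equiv> \<lambda>s. 0" and "cV \<equiv> \<lambda>s. 0" and "C \<equiv> \<lambda>r. 1"
  shows "E_tt \<beta> \<kappa> cA cC cV A C \<psi> r = 0" and "E_rr \<beta> \<kappa> cA cC cV A C \<psi> r = 0"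
    and "E_thth \<beta> \<kappa> cA cC cV A C \<psi> r = 0" and "E_psi \<beta> \<kappa> cA cC cV A C \<psi> r = 0"
proof -
  have r0: "0 < r" "A r \<noteq> 0" using pos[OF r] by auto
  have a1: "deriv A r = (1 - A r) * (2 - A r) / (r * A r)" using dA[OF r] by (rule DERIV_imp_deriv)
  have p1: "deriv \<psi> r = 3 * (1 - A r) * \<psi> r / (2 * r * A r)" using d\<psi>[OF r] by (rule DERIV_imp_deriv)
  have a2: "deriv (deriv A) r = ((A r - 3) * deriv A r - r * (deriv A r)^2) / (r * A r)"
  proof (rule deriv_deriv_eqI[OF assms(1) r dA])
    show "((\<lambda>r. (1 - A r) * (2 - A r) / (r * A r)) has_real_derivative
            ((A r - 3) * deriv A r - r * (deriv A r)^2) / (r * A r)) (at r)"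
      by (rule derivative_eq_intros dA[OF r] refl)+
        (use r0 in \<open>simp_all add: a1 field_simps power2_eq_square\<close>)
  qed
  have p2: "deriv (deriv \<psi>) r = ((3 - 5 * A r) * deriv \<psi> r - 3 * deriv A r * \<psi> r
                                   - 2 * r * deriv A r * deriv \<psi> r) / (2 * r * A r)"
  proof (rule deriv_deriv_eqI[OF assms(1) r d\<psi>])
    show "((\<lambda>r. 3 * (1 - A r) * \<psi> r / (2 * r * A r)) has_real_derivative
            ((3 - 5 * A r) * deriv \<psi> r - 3 * deriv A r * \<psi> r - 2 * r * deriv A r * deriv \<psi> r)
            / (2 * r * A r)) (at r)"
      by (rule derivative_eq_intros dA[OF r] d\<psi>[OF r] refl)+
        (use r0 in \<open>simp_all add: a1 p1 field_simps\<close>)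
  qed
  have dcA: "deriv cA s = 3 * \<beta> / 4 * s" for s
    unfolding cA_def by (rule DERIV_imp_deriv) (rule derivative_eq_intros refl | simp)+
  have data: "C r = 1" "deriv C r = 0" "deriv cC s = 0" "deriv (deriv cC) s = 0" "cV s = 0" "deriv cV s = 0"
    "cA s = 3 * \<beta> / 8 * s^2" for s
    by (simp_all add: C_def cC_def cV_def cA_def)
  note identities = field_equation_identities[OF r0 a1 a2 p1 p2, of \<beta>]
  show "E_tt \<beta> \<kappa> cA cC cV A C \<psi> r = 0"
    unfolding E_tt_def Let_def data dcA using identities(1) by simp
  show "E_rr \<beta> \<kappa> cA cC cV A C \<psi> r = 0"
    unfolding E_rr_def Let_def data dcA using identities(2) by simp
  show "E_thth \<beta> \<kappa> cA cC cV A C \<psi> r = 0"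
    unfolding E_thth_def Let_def data dcA using identities(3) by simp
  show "E_psi \<beta> \<kappa> cA cC cV A C \<psi> r = 0"
    unfolding E_psi_def Let_def data dcA using identities(4) by simp
qed

lemma first_order_system_of_root_ode:
  fixes w :: "real \<Rightarrow> real" and c r :: real
  assumes "0 < r" and w: "0 < w r"
    and dw: "(w has_real_derivative (1 - (w r)^2) / (2 * r * w r)) (at r)"
  defines "A \<equiv> \<lambda>r. 2 * w r / (1 + w r)" and "\<psi> \<equiv> \<lambda>r. c * (1 + w r) powr (3/2)"
  shows "(A has_real_derivative (1 - A r) * (2 - A r) / (r * A r)) (at r)"
    and "(\<psi> has_real_derivative 3 * (1 - A r) * \<psi> r / (2 * r * A r)) (at r)"
proof -
  define d where "d = (1 - (w r)^2) / (2 * r * w r)"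
  note dw = dw[folded d_def]
  have w1: "0 < 1 + w r" using w by simp
  have "(A has_real_derivative 2 * d / (1 + w r)^2) (at r)"
    unfolding A_def apply (rule derivative_eq_intros dw refl)+
    using w1 by (simp_all add: power2_eq_square algebra_simps)
  also have "2 * d / (1 + w r)^2 = (1 - A r) * (2 - A r) / (r * A r)"
    unfolding A_def d_def using w assms(1) by (simp add: power2_eq_square field_simps)
  finally show "(A has_real_derivative (1 - A r) * (2 - A r) / (r * A r)) (at r)" .
  have p: "(1 + w r) powr (3/2) = (1 + w r) * (1 + w r) powr (1/2)"
    using powr_add[of "1 + w r" 1 "1/2"] w1 by simp
  have "(\<psi> has_real_derivative c * (3/2 * d * (1 + w r) powr (1/2))) (at r)"
    unfolding \<psi>_def by (rule derivative_eq_intros dw w1 refl)+ simp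
  also have "c * (3/2 * d * (1 + w r) powr (1/2)) = 3 * (1 - A r) * \<psi> r / (2 * r * A r)"
    unfolding A_def \<psi>_def d_def p using w w1 assms(1)
    by (simp add: divide_simps) (simp add: algebra_simps power2_eq_square)
  finally show "(\<psi> has_real_derivative 3 * (1 - A r) * \<psi> r / (2 * r * A r)) (at r)" .
qed

definition schwarzschild_root :: "real \<Rightarrow> real \<Rightarrow> real" where
  "schwarzschild_root K r = sqrt (1 - 4 * K / r)"

lemma schwarzschild_root_pos: "0 < r \<Longrightarrow> 4 * K < r \<Longrightarrow> 0 < schwarzschild_root K r"
  by (simp add: schwarzschild_root_def field_simps)

lemma has_real_derivative_schwarzschild_root:
  assumes "0 < r" "4 * K < r"
  defines "w \<equiv> schwarzschild_root K r"
  shows "(schwarzschild_root K has_real_derivative (1 - w^2) / (2 * r * w)) (at r)"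
proof -
  have pos: "0 < 1 - 4 * K / r" using assms by (simp add: field_simps)
  have "((\<lambda>r. 1 - 4 * K / r) has_real_derivative 4 * K / r^2) (at r)"
    by (rule derivative_eq_intros refl | use assms in force)+ (use assms in \<open>simp add: power2_eq_square\<close>)
  from DERIV_chain2[OF DERIV_real_sqrt[OF pos] this]
  have "((\<lambda>r. sqrt (1 - 4 * K / r)) has_real_derivative 4 * K / r^2 / (2 * sqrt (1 - 4 * K / r))) (at r)"
    by (simp add: field_simps)
  moreover have "4 * K / r^2 / (2 * sqrt (1 - 4 * K / r)) = (1 - w^2) / (2 * r * w)"
    using assms pos by (simp add: w_def schwarzschild_root_def field_simps power2_eq_square)
  ultimately show ?thesis by (simp add: schwarzschild_root_def[abs_def])
qed

lemma schwarzschild_root_parametrization: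
  assumes "0 < r" "4 * K < r"
  obtains s v where "0 < s" "0 < v" "r = s^2" "K = (s - v) * (s + v) / 4"
    and "sqrt (r - 4 * K) = v" and "sqrt (r * (r - 4 * K)) = s * v"
    and "schwarzschild_root K r = v / s"
proof (rule that[of "sqrt r" "sqrt (r - 4 * K)"])
  show "K = (sqrt r - sqrt (r - 4 * K)) * (sqrt r + sqrt (r - 4 * K)) / 4"
    using assms by (simp add: algebra_simps)
  show "schwarzschild_root K r = sqrt (r - 4 * K) / sqrt r"
    using assms by (simp add: schwarzschild_root_def real_sqrt_divide[symmetric] field_simps)
qed (use assms in \<open>simp_all add: real_sqrt_mult\<close>)

lemma metric_function_eq:
  fixes K r :: real
  assumes "K \<noteq> 0" "0 < r" "4 * K < r"
  shows "2 - r / (2 * K) + sqrt (r * (r - 4 * K)) / (2 * K)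
           = 2 * schwarzschild_root K r / (1 + schwarzschild_root K r)"
proof -
  obtain s v where sv: "0 < s" "0 < v" "r = s^2" "K = (s - v) * (s + v) / 4"
    and "sqrt (r - 4 * K) = v" and sq: "sqrt (r * (r - 4 * K)) = s * v"
    and w: "schwarzschild_root K r = v / s"
    using schwarzschild_root_parametrization[OF assms(2,3)] .
  have "s - v \<noteq> 0" "s + v \<noteq> 0" using assms(1) sv by auto
  then show ?thesis
    unfolding sq w unfolding sv(3,4) using sv(1)
    by (simp add: divide_simps) (simp add: algebra_simps power2_eq_square)
qed

lemma scalar_field_eq:
  fixes K r \<psi>\<^sub>0 :: real
  assumes "K \<noteq> 0" "0 < r" "4 * K < r"
  shows "\<psi>\<^sub>0 * (sqrt (r * (r - 4 * K)) - 4 * K + r) * (sqrt (r * (r - 4 * K)) - 2 * K + r) powr (1/4)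
           / (3 * K * r powr (3/4) * sqrt (r - 4 * K))
         = \<psi>\<^sub>0 / (3 * K * 2 powr (1/4)) * (1 + schwarzschild_root K r) powr (3/2)"
proof -
  obtain s v where sv: "0 < s" "0 < v" "r = s^2" "K = (s - v) * (s + v) / 4"
    and v: "sqrt (r - 4 * K) = v" and sq: "sqrt (r * (r - 4 * K)) = s * v"
    and w: "schwarzschild_root K r = v / s"
    using schwarzschild_root_parametrization[OF assms(2,3)] .
  define u where "u = s + v"
  have u: "0 < u" using sv by (simp add: u_def)
  have first: "s * v - 4 * K + r = v * u"
    unfolding sv(3,4) u_def by (simp add: field_simps power2_eq_square)
  have "s * v - 2 * K + r = u^2 / 2"
    unfolding sv(3,4) u_def by (simp add: field_simps power2_eq_square)
  moreover have "u^2 = u powr 2" using u by simp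
  ultimately have "(s * v - 2 * K + r) powr (1/4) = u powr (2 * (1/4)) / 2 powr (1/4)"
    by (simp only: powr_divide powr_powr)
  then have second: "(s * v - 2 * K + r) powr (1/4) = u powr (1/2) / 2 powr (1/4)" by simp
  have "s^2 = s powr 2" using sv(1) by simp
  then have "r powr (3/4) = s powr (2 * (3/4))" unfolding sv(3) by (simp only: powr_powr)
  then have r_powr: "r powr (3/4) = s powr (3/2)" by simp
  have "1 + schwarzschild_root K r = u / s" using sv(1) by (simp add: w u_def field_simps)
  then have root: "(1 + schwarzschild_root K r) powr (3/2) = u * u powr (1/2) / s powr (3/2)"
    using u sv(1) powr_add[of u 1 "1/2"] by (simp add: powr_divide)
  show ?thesis
    unfolding sq first second r_powr root v using sv(2) assms(1) by (simp add: field_simps)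
qed

lemma metric_function_tendsto:
  fixes K :: real
  assumes "K \<noteq> 0"
  shows "((\<lambda>r. 2 - r / (2 * K) + sqrt (r * (r - 4 * K)) / (2 * K)) \<longlongrightarrow> 1) at_top"
proof -
  have "((\<lambda>r. 4 * K / r) \<longlongrightarrow> 0) at_top"
    by (intro tendsto_divide_0[OF tendsto_const] filterlim_at_top_imp_at_infinity filterlim_ident)
  then have "(schwarzschild_root K \<longlongrightarrow> sqrt (1 - 0)) at_top"
    unfolding schwarzschild_root_def[abs_def] by (intro tendsto_intros)
  then have "((\<lambda>r. 2 * schwarzschild_root K r / (1 + schwarzschild_root K r)) \<longlongrightarrow> 2 * 1 / (1 + 1)) at_top"
    by (intro tendsto_intros) auto
  moreover have "eventually (\<lambda>r. 2 * schwarzschild_root K r / (1 + schwarzschild_root K r)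
      = 2 - r / (2 * K) + sqrt (r * (r - 4 * K)) / (2 * K)) at_top"
    using eventually_gt_at_top[of "max 0 (4 * K)"] by eventually_elim (simp add: metric_function_eq[OF assms])
  ultimately show ?thesis by (simp add: tendsto_cong)
qed

lemma explicit_solution_first_order_system:
  fixes K \<psi>\<^sub>0 :: real and I :: "real set" and A \<psi> :: "real \<Rightarrow> real"
  assumes "K \<noteq> 0"
    and I_def: "I \<equiv> {r::real. r > 0 \<and> r > 4 * K}"
    and A_def: "A \<equiv> \<lambda>r::real. 2 - r / (2*K) + sqrt (r * (r - 4*K)) / (2*K)"
    and \<psi>_def: "\<psi> \<equiv> \<lambda>r::real. \<psi>\<^sub>0 * (sqrt (r * (r - 4*K)) - 4*K + r)
                 * (sqrt (r * (r - 4*K)) - 2*K + r) powr (1/4)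
                 / (3 * K * r powr (3/4) * sqrt (r - 4*K))"
  shows "open I"
    and "\<And>r. r \<in> I \<Longrightarrow> 0 < r \<and> A r \<noteq> 0"
    and "\<And>r. r \<in> I \<Longrightarrow> (A has_real_derivative (1 - A r) * (2 - A r) / (r * A r)) (at r)"
    and "\<And>r. r \<in> I \<Longrightarrow> (\<psi> has_real_derivative 3 * (1 - A r) * \<psi> r / (2 * r * A r)) (at r)"
proof -
  define w where "w = schwarzschild_root K"
  define c where "c = \<psi>\<^sub>0 / (3 * K * 2 powr (1/4))"
  have I: "I = {0<..} \<inter> {4 * K<..}" unfolding I_def by auto
  then show "open I" by auto
  have A: "A r = 2 * w r / (1 + w r)" and \<psi>: "\<psi> r = c * (1 + w r) powr (3/2)" if "r \<in> I" for r
    using that metric_function_eq[OF assms(1)] scalar_field_eq[OF assms(1)]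
    by (simp_all add: I_def A_def \<psi>_def w_def c_def)
  fix r assume r: "r \<in> I"
  then have r0: "0 < r" "4 * K < r" by (simp_all add: I)
  have w: "0 < w r" unfolding w_def using r0 by (rule schwarzschild_root_pos)
  then show "0 < r \<and> A r \<noteq> 0" using r0 by (simp add: A[OF r])
  note system =
    first_order_system_of_root_ode[OF r0(1) w has_real_derivative_schwarzschild_root[OF r0, folded w_def]]
  show "(A has_real_derivative (1 - A r) * (2 - A r) / (r * A r)) (at r)"
    by (rule has_field_derivative_transform_within_open[OF system(1)[folded A[OF r]] \<open>open I\<close> r])
      (simp add: A)
  show "(\<psi> has_real_derivative 3 * (1 - A r) * \<psi> r / (2 * r * A r)) (at r)"
    by (rule has_field_derivative_transform_within_open
        [OF system(2)[where c = c, folded A[OF r] \<psi>[OF r]] \<open>open I\<close> r])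
      (simp add: \<psi>)
qed

theorem mainTheorem6:
  fixes \<beta> \<psi>\<^sub>0 \<kappa> K :: real
  assumes "\<kappa> > 0" and "K \<noteq> 0"
  defines "I \<equiv> {r::real. r > 0 \<and> r > 4 * K}"
    and "cC \<equiv> (\<lambda>s::real. 0::real)"
    and "cV \<equiv> (\<lambda>s::real. 0::real)"
    and "cA \<equiv> (\<lambda>s::real. 3 * \<beta> / 8 * s^2)"
    and "C \<equiv> (\<lambda>r::real. 1::real)"
    and "A \<equiv> (\<lambda>r::real. 2 - r / (2*K) + sqrt (r * (r - 4*K)) / (2*K))"
    and "\<psi> \<equiv> (\<lambda>r::real. \<psi>\<^sub>0 * (sqrt (r * (r - 4*K)) - 4*K + r)
                 * (sqrt (r * (r - 4*K)) - 2*K + r) powr (1/4)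
                 / (3 * K * r powr (3/4) * sqrt (r - 4*K)))"
  shows "(\<forall>r\<in>I. E_tt \<beta> \<kappa> cA cC cV A C \<psi> r = 0 \<and> E_rr \<beta> \<kappa> cA cC cV A C \<psi> r = 0
                \<and> E_thth \<beta> \<kappa> cA cC cV A C \<psi> r = 0 \<and> E_psi \<beta> \<kappa> cA cC cV A C \<psi> r = 0)
         \<and> (A \<longlongrightarrow> 1) at_top
         \<and> (K > 0 \<longrightarrow> A (4*K) = 0)"
proof (intro conjI ballI impI)
  note solution = explicit_solution_first_order_system[OF assms(2) I_def A_def \<psi>_def]
  fix r assume "r \<in> I"
  note field_equations =
    field_equations_of_first_order_system[OF solution(1) this solution(2-4), where \<beta> = \<beta> and \<kappa> = \<kappa>]
  show "E_tt \<beta> \<kappa> cA cC cV A C \<psi> r = 0" "E_rr \<beta> \<kappa> cA cC cV A C \<psi> r = 0"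
    "E_thth \<beta> \<kappa> cA cC cV A C \<psi> r = 0" "E_psi \<beta> \<kappa> cA cC cV A C \<psi> r = 0"
    using field_equations unfolding cA_def cC_def cV_def C_def by simp_all
next
  show "(A \<longlongrightarrow> 1) at_top" unfolding A_def using assms(2) by (rule metric_function_tendsto)
next
  show "A (4 * K) = 0" unfolding A_def using assms(2) by simp
qed

end
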